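(* Let $0<s\le1$, let $\{h_\ell\}_{\ell\ge0}$ be the sequence of mesh widths, and suppose the cost per sample satisfies $\mathcal C_\ell\le C_\gamma h_\ell^{-\gamma}$ for all $\ell$, for some $\gamma>0$ and $C_\gamma>0$. (a) Suppose $e\big(\widehat Q^{\mathrm{ML}}_{h_L,\{N_\ell\}}/\widehat Z^{\mathrm{ML}}_{h_L,\{N_\ell\}}\big)^2\le C_{\mathrm{ML}}\big(\sum_{\ell=0}^L h_\ell^{4s}/N_\ell+h_L^{4s}\big)$ for all $L$ and $\{N_\ell\}$, with $C_{\mathrm{ML}}$ independent of $\{h_\ell\},\{N_\ell\},L$. Then there is a constant $C^{\mathrm{ML}}>0$ such that for any $\varepsilon<e^{-1}$ there exist $L\in\mathbb N$ and $\{N_\ell\}_{\ell=0}^L$ with $$e\big(\widehat Q^{\mathrm{ML}}_{h_L,\{N_\ell\}}/\widehat Z^{\mathrm{ML}}_{h_L,\{N_\ell\}}\big)^2\le\varepsilon^2\quad\text{and}\quad \mathcal C_{\mathrm{ML}}\le\begin{cases}C^{\mathrm{ML}}\varepsilon^{-2},& s>\gamma/4,\\ C^{\mathrm{ML}}\varepsilon^{-2}(\log\varepsilon)^2,& s=\gamma/4,\\ C^{\mathrm{ML}}\varepsilon^{-\gamma/(2s)},& s<\gamma/4.\end{cases}$$ (b) Suppose $e\big(\widehat Q^{\mathrm{MC}}_{h,N}/\widehat Z^{\mathrm{MC}}_{h,N}\big)^2\le C_{\mathrm{MC}}(N^{-1}+h^{4s})$ for all $h\in\{h_\ell\}$ and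 $N$, with $C_{\mathrm{MC}}$ independent of $h$ and $N$. Then there is a constant $C^{\mathrm{MC}}>0$ such that for any $\varepsilon<e^{-1}$ there are values of $h$ and $N$ with $e\big(\widehat Q^{\mathrm{MC}}_{h,N}/\widehat Z^{\mathrm{MC}}_{h,N}\big)^2\le\varepsilon^2$ and $\mathcal C_{\mathrm{MC}}\le C^{\mathrm{MC}}\varepsilon^{-2-\gamma/(2s)}$. (c) Suppose $e\big(\widehat Q^{\mathrm{QMC}}_{h,N}/\widehat Z^{\mathrm{QMC}}_{h,N}\big)^2\le C_{\mathrm{QMC}}(N^{-1/\delta}+h^{4s})$ for all $h\in\{h_\ell\}$ and $N\ge2$ and some $1/2<\delta\le1$, with $C_{\mathrm{QMC}}$ independent of $h$ and $N$. Then there is a constant $C^{\mathrm{QMC}}>0$ such that for any $\varepsilon<e^{-1}$ there are values of $h$ and $N$ with $e\big(\widehat Q^{\mathrm{QMC}}_{h,N}/\widehat Z^{\mathrm{QMC}}_{h,N}\big)^2\le\varepsilon^2$ and $\mathcal C_{\mathrm{QMC}}\le C^{\mathrm{QMC}}\varepsilon^{-2\delta-\gamma/(2s)}$. The constants $C^{\mathrm{ML}},C^{\mathrm{MC}},C^{\mathrm{QMC}}$ are independent of $\varepsilon$, and $0<\varepsilon<e^{-1}$ throughout.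
   Context: **Setting.** $p(\cdot;\xi)\in H^1_0(D)$ is the weak solution of $-\nabla\cdot(k(x;\xi)\nabla p)=f$ in a bounded Lipschitz polygonal/polyhedral domain $D\subset\mathbb R^d$, $p=0$ on $\partial D$, where the coefficient $k$ depends on a random vector $\xi\in\mathbb R^J$ with law $\mathbb P$; $p_h(\cdot;\xi)$ is its continuous piecewise linear finite element approximation on a mesh of width $h$. $\mathcal H:H^1_0(D)\to\mathbb R^m$, $\phi:H^1_0(D)\to\mathbb R$, $y\in\mathbb R^m$, $\sigma_\eta>0$; $\theta(v)=\exp(-\frac1{2\sigma_\eta^2}|y-\mathcal H(v)|^2)$, $\psi=\theta\phi$; $Z=\mathbb E_{\mathbb P}[\theta(p)]$, $Q=\mathbb E_{\mathbb P}[\psi(p)]$. **Meshes.** $h_0>h_1>\cdots$ is a sequence of mesh widths with $k_1\le h_{\ell-1}/h_\ell\le k_2$ for all $\ell\ge1$ and fixed $1<k_1\le k_2<\infty$. **Estimators** (for $Q$; those for $Z$ have $\theta$ in place of $\psi$). MC: $\widehat Q^{\mathrm{MC}}_{h,N}=\frac1N\sum_{i=1}^N\psi(p_h(\cdot;\xi^{(i)}))$, $\xi^{(i)}$ i.i.d. from $\mathbb P$. QMC: $\widehat Q^{\mathrm{QMC}}_{h,N}=\frac1N\sum_{i=1}^N\psi\big(p_h(\cdot;\Phi_J^{-1}(\mathrm{frac}(iz/N+\Delta)))\big)$ with generating vector $z\in\{1,\dots,N-1\}^J$ (chosen for each $N$), random shift $\Delta$ uniform on $[0,1]^J$, $\mathrm{frac}$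 the componentwise fractional part, and $\Phi_J^{-1}$ the componentwise inverse cdf of the components of $\xi$. MLMC: $\widehat Q^{\mathrm{ML}}_{h_L,\{N_\ell\}}=\sum_{\ell=0}^L\frac1{N_\ell}\sum_{i=1}^{N_\ell}Y_\ell(\xi^{(i,\ell)})$ with $Y_0=\psi(p_{h_0})$, $Y_\ell=\psi(p_{h_\ell})-\psi(p_{h_{\ell-1}})$ for $\ell\ge1$, and independent samples $\xi^{(i,\ell)}$ from $\mathbb P$. Here $N,N_\ell$ are positive integers. **Error and cost.** $e(\widehat Q_h/\widehat Z_h)^2=\mathbb E\big[(Q/Z-\widehat Q_h/\widehat Z_h)^2\big]$, expectation over the samples or over the shift. $\mathcal C_\ell$ is the cost of obtaining one sample of $\theta(p_{h_\ell})$ and/or $\psi(p_{h_\ell})$. $\mathcal C_{\mathrm{MC}},\mathcal C_{\mathrm{QMC}},\mathcal C_{\mathrm{ML}}$ are the total costs of the ratio estimators; up to a fixed constant factor (accounting for whether samples are shared between numerator and denominator) they are $N\mathcal C_\ell$ for MC and QMC with $h=h_\ell$, and $N_0\mathcal C_0+\sum_{\ell=1}^LN_\ell(\mathcal C_\ell+\mathcal C_{\ell-1})$ for MLMC. *)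

theory Defs
  imports "HOL-Probability.Probability"
begin

section \<open>The domain and the space \<open>H\<^sup>1\<^sub>0(D)\<close>\<close>

text \<open>Near each boundary point, \<open>D\<close> is the strict epigraph, in direction \<open>n\<close>, of a Lipschitz
  function of the component orthogonal to \<open>n\<close>.\<close>

definition lipschitz_boundary :: "(real ^ 'd) set \<Rightarrow> bool" where
  "lipschitz_boundary D \<longleftrightarrow>
     (\<forall>x0\<in>frontier D. \<exists>n r L g. norm n = 1 \<and> r > 0 \<and> L-lipschitz_on UNIV (g :: real ^ 'd \<Rightarrow> real) \<and>
        D \<inter> ball x0 r = {x \<in> ball x0 r. g (x - (x \<bullet> n) *\<^sub>R n) < x \<bullet> n})"

definition lipschitz_polyhedral_domain :: "(real ^ 'd) set \<Rightarrow> bool" where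
  "lipschitz_polyhedral_domain D \<longleftrightarrow>
     open D \<and> connected D \<and> D \<noteq> {} \<and> bounded D \<and> lipschitz_boundary D \<and>
     (\<exists>\<P>. finite \<P> \<and> (\<forall>P\<in>\<P>. polytope P) \<and> closure D = \<Union>\<P>)"

text \<open>Elements of \<open>L\<^sup>2(D)\<close> and of the Sobolev spaces are represented by functions on the whole space,
  of which only the values on \<open>D\<close>, up to null sets, matter.\<close>

definition L2 :: "(real ^ 'd) set \<Rightarrow> (real ^ 'd \<Rightarrow> 'b::euclidean_space) set" where
  "L2 D = {u. u \<in> borel_measurable (lebesgue_on D) \<and> integrable (lebesgue_on D) (\<lambda>x. (norm (u x))\<^sup>2)}"

primrec is_C :: "nat \<Rightarrow> (real ^ 'd \<Rightarrow> real) \<Rightarrow> bool" where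
  "is_C 0 u \<longleftrightarrow> continuous_on UNIV u"
| "is_C (Suc n) u \<longleftrightarrow> u differentiable_on UNIV \<and> (\<forall>v. is_C n (\<lambda>x. frechet_derivative u (at x) v))"

definition test_function :: "(real ^ 'd) set \<Rightarrow> (real ^ 'd \<Rightarrow> real) \<Rightarrow> bool" where
  "test_function D w \<longleftrightarrow>
     (\<forall>n. is_C n w) \<and> compact (closure {x. w x \<noteq> 0}) \<and> closure {x. w x \<noteq> 0} \<subseteq> D"

definition weak_gradient :: "(real ^ 'd) set \<Rightarrow> (real ^ 'd \<Rightarrow> real) \<Rightarrow> (real ^ 'd \<Rightarrow> real ^ 'd) \<Rightarrow> bool" where
  "weak_gradient D u g \<longleftrightarrow> u \<in> L2 D \<and> g \<in> L2 D \<and>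
     (\<forall>w. test_function D w \<longrightarrow> (\<forall>i.
        (LINT x|lebesgue_on D. u x * frechet_derivative w (at x) (axis i 1)) =
        - (LINT x|lebesgue_on D. g x $ i * w x)))"

definition H1 :: "(real ^ 'd) set \<Rightarrow> (real ^ 'd \<Rightarrow> real) set" where
  "H1 D = {u. \<exists>g. weak_gradient D u g}"

text \<open>The weak gradient is unique up to null sets, so any choice will do.\<close>

definition wgrad :: "(real ^ 'd) set \<Rightarrow> (real ^ 'd \<Rightarrow> real) \<Rightarrow> real ^ 'd \<Rightarrow> real ^ 'd" where
  "wgrad D u = (SOME g. weak_gradient D u g)"

definition H1_norm :: "(real ^ 'd) set \<Rightarrow> (real ^ 'd \<Rightarrow> real) \<Rightarrow> real" where
  "H1_norm D u = sqrt ((LINT x|lebesgue_on D. (u x)\<^sup>2) + (LINT x|lebesgue_on D. (norm (wgrad D u x))\<^sup>2))"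

definition H10 :: "(real ^ 'd) set \<Rightarrow> (real ^ 'd \<Rightarrow> real) set" where
  "H10 D = {u \<in> H1 D. \<exists>w. (\<forall>n. test_function D (w n)) \<and> (\<lambda>n. H1_norm D (\<lambda>x. w n x - u x)) \<longlonglongrightarrow> 0}"

text \<open>Maps on representatives that induce a map on the space \<open>H\<^sup>1\<^sub>0(D)\<close> of classes.\<close>

definition on_H10 :: "(real ^ 'd) set \<Rightarrow> ((real ^ 'd \<Rightarrow> real) \<Rightarrow> 'b) \<Rightarrow> bool" where
  "on_H10 D F \<longleftrightarrow>
     (\<forall>u\<in>H10 D. \<forall>v\<in>H10 D. (AE x in lebesgue_on D. u x = v x) \<longrightarrow> F u = F v)"

text \<open>The source term is a bounded linear functional on \<open>H\<^sup>1\<^sub>0(D)\<close>; a source density \<open>f \<in> L\<^sup>2(D)\<close>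
  corresponds to the functional \<open>v \<mapsto> \<integral>\<^sub>D f v\<close>.\<close>

definition Hminus1 :: "(real ^ 'd) set \<Rightarrow> ((real ^ 'd \<Rightarrow> real) \<Rightarrow> real) set" where
  "Hminus1 D = {f. (\<forall>u\<in>H10 D. \<forall>v\<in>H10 D. \<forall>a b. f (\<lambda>x. a * u x + b * v x) = a * f u + b * f v) \<and>
                   (\<exists>B. \<forall>v\<in>H10 D. \<bar>f v\<bar> \<le> B * H1_norm D v)}"


section \<open>Weak and finite element solutions\<close>

definition variational_solution ::
  "(real ^ 'd) set \<Rightarrow> (real ^ 'd \<Rightarrow> real) \<Rightarrow> ((real ^ 'd \<Rightarrow> real) \<Rightarrow> real) \<Rightarrow> (real ^ 'd \<Rightarrow> real) set \<Rightarrow>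
   (real ^ 'd \<Rightarrow> real) \<Rightarrow> bool" where
  "variational_solution D k f V u \<longleftrightarrow> u \<in> V \<and>
     (\<forall>v\<in>V. integrable (lebesgue_on D) (\<lambda>x. k x * (wgrad D u x \<bullet> wgrad D v x)) \<and>
            (LINT x|lebesgue_on D. k x * (wgrad D u x \<bullet> wgrad D v x)) = f v)"

text \<open>The solution, i.e. the only one up to null sets.\<close>

definition the_variational_solution ::
  "(real ^ 'd) set \<Rightarrow> (real ^ 'd \<Rightarrow> real) \<Rightarrow> ((real ^ 'd \<Rightarrow> real) \<Rightarrow> real) \<Rightarrow> (real ^ 'd \<Rightarrow> real) set \<Rightarrow>
   (real ^ 'd \<Rightarrow> real) \<Rightarrow> bool" where
  "the_variational_solution D k f V u \<longleftrightarrow> variational_solution D k f V u \<and>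
     (\<forall>u'. variational_solution D k f V u' \<longrightarrow> (AE x in lebesgue_on D. u' x = u x))"

definition mesh_of_width :: "(real ^ 'd) set \<Rightarrow> real \<Rightarrow> (real ^ 'd) set set \<Rightarrow> bool" where
  "mesh_of_width D h \<T> \<longleftrightarrow> triangulation \<T> \<and> \<Union>\<T> = closure D \<and>
     (\<forall>K\<in>\<T>. int (CARD('d)) simplex K) \<and> h = Max (diameter ` \<T>)"

definition P1_space :: "(real ^ 'd) set \<Rightarrow> (real ^ 'd) set set \<Rightarrow> (real ^ 'd \<Rightarrow> real) set" where
  "P1_space D \<T> = {v. continuous_on (closure D) v \<and> (\<forall>x\<in>frontier D. v x = 0) \<and>
                      (\<forall>K\<in>\<T>. \<exists>a b. \<forall>x\<in>K. v x = a \<bullet> x + b)}"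

definition mesh_width_sequence :: "real \<Rightarrow> real \<Rightarrow> (nat \<Rightarrow> real) \<Rightarrow> bool" where
  "mesh_width_sequence k1 k2 h \<longleftrightarrow> 1 < k1 \<and> k1 \<le> k2 \<and> (\<forall>l. 0 < h l) \<and> (\<forall>l. h (Suc l) < h l) \<and>
     (\<forall>l\<ge>1. k1 \<le> h (l - 1) / h l \<and> h (l - 1) / h l \<le> k2)"


section \<open>Estimators, errors and costs\<close>

definition likelihood :: "real \<Rightarrow> real ^ 'm \<Rightarrow> ('v \<Rightarrow> real ^ 'm) \<Rightarrow> 'v \<Rightarrow> real" where
  "likelihood \<sigma> y H v = exp (- (1 / (2 * \<sigma>\<^sup>2)) * (norm (y - H v))\<^sup>2)"

definition iid_samples :: "'w measure \<Rightarrow> (real ^ 'J) measure \<Rightarrow> ('i \<Rightarrow> 'w \<Rightarrow> real ^ 'J) \<Rightarrow> bool" where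
  "iid_samples M P X \<longleftrightarrow>
     prob_space.indep_vars M (\<lambda>_. borel) X UNIV \<and> (\<forall>i. distr M borel (X i) = P)"

definition uniform_shift :: "'w measure \<Rightarrow> ('w \<Rightarrow> real ^ 'J) \<Rightarrow> bool" where
  "uniform_shift M \<Delta> \<longleftrightarrow> \<Delta> \<in> borel_measurable M \<and>
     distr M borel \<Delta> = uniform_measure lborel {x. \<forall>j. 0 \<le> x $ j \<and> x $ j \<le> 1}"

text \<open>The quantile function; it is the inverse of the cdf where the latter is invertible. Its values
  outside \<open>(0, 1)\<close> are irrelevant: shifted lattice points almost surely lie in \<open>(0, 1)\<^sup>J\<close>.\<close>

definition inv_cdf :: "real measure \<Rightarrow> real \<Rightarrow> real" where
  "inv_cdf \<mu> t = Inf {x. t \<le> cdf \<mu> x}"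

definition comp_inv_cdf :: "(real ^ 'J) measure \<Rightarrow> real ^ 'J \<Rightarrow> real ^ 'J" where
  "comp_inv_cdf P t = (\<chi> j. inv_cdf (distr P borel (\<lambda>\<xi>. \<xi> $ j)) (t $ j))"

text \<open>In the estimators, \<open>g\<close> is one of the maps \<open>\<xi> \<mapsto> \<theta>(p\<^sub>h(\<cdot>;\<xi>))\<close> and \<open>\<xi> \<mapsto> \<psi>(p\<^sub>h(\<cdot>;\<xi>))\<close>; the multilevel
  estimator takes the family of such maps indexed by the level.\<close>

definition MC_est :: "('x \<Rightarrow> real) \<Rightarrow> (nat \<Rightarrow> 'w \<Rightarrow> 'x) \<Rightarrow> nat \<Rightarrow> 'w \<Rightarrow> real" where
  "MC_est g X N \<omega> = 1 / real N * (\<Sum>i = 1..N. g (X i \<omega>))"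

definition QMC_est ::
  "(real ^ 'J) measure \<Rightarrow> (real ^ 'J \<Rightarrow> real) \<Rightarrow> nat ^ 'J \<Rightarrow> ('w \<Rightarrow> real ^ 'J) \<Rightarrow> nat \<Rightarrow> 'w \<Rightarrow> real" where
  "QMC_est P g z \<Delta> N \<omega> = 1 / real N *
     (\<Sum>i = 1..N. g (comp_inv_cdf P (\<chi> j. frac (real i * real (z $ j) / real N + \<Delta> \<omega> $ j))))"

definition MLMC_diff :: "(nat \<Rightarrow> 'x \<Rightarrow> real) \<Rightarrow> nat \<Rightarrow> 'x \<Rightarrow> real" where
  "MLMC_diff g l \<xi> = (if l = 0 then g 0 \<xi> else g l \<xi> - g (l - 1) \<xi>)"

definition MLMC_est ::
  "(nat \<Rightarrow> 'x \<Rightarrow> real) \<Rightarrow> (nat \<times> nat \<Rightarrow> 'w \<Rightarrow> 'x) \<Rightarrow> nat \<Rightarrow> (nat \<Rightarrow> nat) \<Rightarrow> 'w \<Rightarrow> real" where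
  "MLMC_est g X L N \<omega> = (\<Sum>l = 0..L. 1 / real (N l) * (\<Sum>i = 1..N l. MLMC_diff g l (X (i, l) \<omega>)))"

text \<open>The mean square error \<open>e(Qhat/Zhat)\<^sup>2\<close> takes values in \<open>[0, \<infinity>]\<close>, so that a bound on it
  includes its finiteness. \<open>Qhat\<close> and \<open>Zhat\<close> may be driven by the same samples (or shift) or by
  different ones; their joint law is unrestricted. Where \<open>Zhat\<close> vanishes the quotient is \<open>0\<close>.\<close>

definition ratio_mse :: "'w measure \<Rightarrow> real \<Rightarrow> real \<Rightarrow> ('w \<Rightarrow> real) \<Rightarrow> ('w \<Rightarrow> real) \<Rightarrow> ennreal" where
  "ratio_mse M Q Z Qhat Zhat = (\<integral>\<^sup>+\<omega>. ennreal ((Q / Z - Qhat \<omega> / Zhat \<omega>)\<^sup>2) \<partial>M)"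

text \<open>Total costs; \<open>\<kappa>\<close> is the constant factor that accounts for whether numerator and denominator
  share samples. \<open>sample_cost\<close> serves both plain and quasi-Monte Carlo.\<close>

definition sample_cost :: "real \<Rightarrow> (nat \<Rightarrow> real) \<Rightarrow> nat \<Rightarrow> nat \<Rightarrow> real" where
  "sample_cost \<kappa> C l N = \<kappa> * (real N * C l)"

definition MLMC_cost :: "real \<Rightarrow> (nat \<Rightarrow> real) \<Rightarrow> nat \<Rightarrow> (nat \<Rightarrow> nat) \<Rightarrow> real" where
  "MLMC_cost \<kappa> C L N = \<kappa> * (real (N 0) * C 0 + (\<Sum>l = 1..L. real (N l) * (C l + C (l - 1))))"

end

theory Submission
  imports Defs
begin

text \<open>The error hypotheses split the mean square error into a bias of order \<open>h\<^bsup>4s\<^esup>\<close>, which only a finer mesh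
  reduces, and a sampling part, which only more samples reduce. Each part is made at most
  \<open>\<epsilon>\<^sup>2 / 2\<close>, and the cost of doing so is counted. The complexity lemmas
  speak of an arbitrary error function \<open>err\<close> that obeys such a bound.

  The bias demands \<open>h \<le> c \<epsilon>\<^bsup>1/(2s)\<^esup>\<close>. Since consecutive widths have bounded ratio, the first such width is
  also at least a fixed multiple of \<open>\<epsilon>\<^bsup>1/(2s)\<^esup>\<close> (\<open>level_resolving_accuracy\<close>), so one sample on that level
  costs \<open>O(\<epsilon>\<^bsup>-\<gamma>/(2s)\<^esup>)\<close>. A sampling error \<open>N\<^bsup>-1/\<delta>\<^esup>\<close> demands \<open>N\<close> of order \<open>\<epsilon>\<^bsup>-2\<delta>\<^esup>\<close>. The product of the two is
  the cost of quasi-Monte Carlo and, for \<open>\<delta> = 1\<close>, of Monte Carlo (\<open>single_level_complexity\<close>).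

  For the multilevel estimator, level \<open>l\<close> contributes \<open>v\<^sub>l / N\<^sub>l\<close> to the error and \<open>N\<^sub>l c\<^sub>l\<close> to the cost, with
  \<open>v\<^sub>l = h\<^sub>l\<^bsup>4s\<^esup>\<close> and \<open>c\<^sub>l = h\<^sub>l\<^bsup>-\<gamma>\<^esup>\<close>. Minimising the cost for a given error makes \<open>N\<^sub>l\<close> proportional to
  \<open>sqrt (v\<^sub>l / c\<^sub>l)\<close>, and the resulting cost is of order \<open>\<epsilon>\<^bsup>-2\<^esup> (\<Sum>\<^sub>l sqrt (v\<^sub>l c\<^sub>l))\<^sup>2 + \<Sum>\<^sub>l c\<^sub>l\<close>, the last sum
  coming from rounding \<open>N\<^sub>l\<close> up to an integer (\<open>optimal_sample_allocation\<close>). Here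
  \<open>sqrt (v\<^sub>l c\<^sub>l) = h\<^sub>l\<^sup>\<tau>\<close> with \<open>\<tau> = 2 s - \<gamma> / 2\<close>, and the widths decay geometrically. The three regimes of
  the theorem are therefore the three signs of \<open>\<tau>\<close>: the sum is dominated by the coarsest level, has
  equal terms on all \<open>O(\<bar>log \<epsilon>\<bar>)\<close> levels, or is dominated by the finest level
  (\<open>sum_level_weights_le_multilevel_rate\<close>).\<close>


section \<open>Geometric sequences of mesh widths\<close>

lemma mesh_width_sequenceD:
  assumes "mesh_width_sequence k1 k2 h"
  shows "1 < k1" and "k1 \<le> k2" and "0 < h l" and "k1 * h (Suc l) \<le> h l" and "h l \<le> k2 * h (Suc l)"
proof -
  show "1 < k1" "k1 \<le> k2" and pos: "0 < h l" for l
    using assms by (auto simp: mesh_width_sequence_def)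
  have "k1 \<le> h (Suc l - 1) / h (Suc l) \<and> h (Suc l - 1) / h (Suc l) \<le> k2"
    using assms unfolding mesh_width_sequence_def by (metis le_add1 plus_1_eq_Suc)
  with pos[of "Suc l"] show "k1 * h (Suc l) \<le> h l" "h l \<le> k2 * h (Suc l)"
    by (auto simp: field_simps)
qed

lemma width_geometric_decay:
  assumes "mesh_width_sequence k1 k2 h"
  shows "k1 ^ l * h l \<le> h 0"
proof (induction l)
  case (Suc l)
  have "k1 ^ Suc l * h (Suc l) = k1 ^ l * (k1 * h (Suc l))"
    by simp
  also have "\<dots> \<le> k1 ^ l * h l"
    using mesh_width_sequenceD(1,4)[OF assms] by (intro mult_left_mono) auto
  finally show ?case
    using Suc by simp
qed simp

lemma width_powr_step:
  assumes "mesh_width_sequence k1 k2 h" and "0 < a"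
  shows "h (Suc l) powr a \<le> k1 powr (- a) * h l powr a"
    and "h l powr (- a) \<le> k1 powr (- a) * h (Suc l) powr (- a)"
proof -
  note m = mesh_width_sequenceD[OF assms(1)]
  have "(k1 * h (Suc l)) powr a \<le> h l powr a"
    using m(1) m(3)[of "Suc l"] m(4)[of l] assms(2) by (intro powr_mono2) auto
  then have *: "k1 powr a * h (Suc l) powr a \<le> h l powr a"
    using m(1) m(3)[of "Suc l"] by (simp add: powr_mult)
  with m(1) m(3)[of l] m(3)[of "Suc l"]
  show "h (Suc l) powr a \<le> k1 powr (- a) * h l powr a"
    and "h l powr (- a) \<le> k1 powr (- a) * h (Suc l) powr (- a)"
    by (simp_all add: powr_minus field_simps)
qed

lemma geometric_ratio_bounds:
  assumes "mesh_width_sequence k1 k2 h" and "0 < a"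
  shows "0 < k1 powr (- a)" and "k1 powr (- a) < 1"
  using mesh_width_sequenceD(1)[OF assms(1)] assms(2) by (auto simp: powr_less_one)

text \<open>For positive exponents the coarsest level dominates the sum, for negative ones the finest. In the
  first bound the induction needs the term \<open>- r h\<^sub>L\<^sup>a\<close>, the remainder of the geometric series, which
  pays for the next summand.\<close>

lemma sum_width_powr_pos_le:
  assumes "mesh_width_sequence k1 k2 h" and "0 < a"
  shows "(\<Sum>l = 0..L. h l powr a) \<le> h 0 powr a / (1 - k1 powr (- a))"
proof -
  define r where "r = k1 powr (- a)"
  have r: "0 < r" "r < 1"
    using geometric_ratio_bounds[OF assms] by (auto simp: r_def)
  have "(1 - r) * (\<Sum>l = 0..L. h l powr a) \<le> h 0 powr a - r * h L powr a"
  proof (induction L)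
    case (Suc L)
    have "h (Suc L) powr a \<le> r * h L powr a"
      using width_powr_step(1)[OF assms] by (simp add: r_def)
    with Suc show ?case
      by (simp add: algebra_simps)
  qed (simp add: algebra_simps)
  also have "\<dots> \<le> h 0 powr a"
    using r by simp
  finally show ?thesis
    using r by (simp add: r_def[symmetric] field_simps)
qed

lemma sum_width_powr_neg_le:
  assumes "mesh_width_sequence k1 k2 h" and "0 < a"
  shows "(\<Sum>l = 0..L. h l powr (- a)) \<le> h L powr (- a) / (1 - k1 powr (- a))"
proof -
  define r where "r = k1 powr (- a)"
  have r: "0 < r" "r < 1"
    using geometric_ratio_bounds[OF assms] by (auto simp: r_def)
  have "(1 - r) * (\<Sum>l = 0..L. h l powr (- a)) \<le> h L powr (- a)"
  proof (induction L)
    case 0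
    have "r * h 0 powr (- a) \<ge> 0"
      using r by simp
    then show ?case by (simp add: algebra_simps)
  next
    case (Suc L)
    have "h L powr (- a) \<le> r * h (Suc L) powr (- a)"
      using width_powr_step(2)[OF assms] by (simp add: r_def)
    with Suc show ?case
      by (simp add: algebra_simps)
  qed
  then show ?thesis
    using r by (simp add: r_def[symmetric] field_simps)
qed

text \<open>The level is the first one with \<open>h\<^sub>L \<le> c \<epsilon>\<^bsup>1/(2s)\<^esup>\<close>. It exists because the widths tend to \<open>0\<close>; being the
  first, its predecessor is coarser than this, so the bound \<open>k2\<close> on the refinement ratio limits how
  far it overshoots. The lower bound on \<open>h\<^sub>L\<close> is what later bounds the cost.\<close>

lemma level_resolving_accuracy:
  fixes h :: "nat \<Rightarrow> real"
  assumes mesh: "mesh_width_sequence k1 k2 h" and "0 < s" and "0 < K"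
  shows "\<exists>b>0. \<forall>\<epsilon>. 0 < \<epsilon> \<and> \<epsilon> < 1 \<longrightarrow>
           (\<exists>L. K * h L powr (4 * s) \<le> \<epsilon>\<^sup>2 / 2 \<and> b * \<epsilon> powr (1 / (2 * s)) \<le> h L)"
proof -
  note m = mesh_width_sequenceD[OF mesh]
  \<comment> \<open>With \<open>c \<le> h 0\<close> the coarsest level is never fine enough, so the chosen level has a predecessor;
    the other bound on \<open>c\<close> makes the bias small.\<close>
  define c where "c = min (h 0) ((1 / (2 * K)) powr (1 / (4 * s)))"
  have c: "0 < c"
    using m(3) \<open>0 < K\<close> by (simp add: c_def)
  have k2: "0 < k2"
    using m(1,2) by simp
  have "\<exists>L. K * h L powr (4 * s) \<le> \<epsilon>\<^sup>2 / 2 \<and> c / k2 * \<epsilon> powr (1 / (2 * s)) \<le> h L"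
    if \<epsilon>: "0 < \<epsilon>" "\<epsilon> < 1" for \<epsilon>
  proof -
    define \<rho> where "\<rho> = c * \<epsilon> powr (1 / (2 * s))"
    have \<rho>: "0 < \<rho>"
      using c \<epsilon> by (simp add: \<rho>_def)
    have "\<epsilon> powr (1 / (2 * s)) < 1"
      using \<epsilon> \<open>0 < s\<close> powr_less_mono2[of "1 / (2 * s)" \<epsilon> 1] by simp
    then have "\<rho> < h 0"
      using c by (smt (verit) \<rho>_def c_def mult_less_cancel_left2)
    obtain n where "h 0 / \<rho> < k1 ^ n"
      using real_arch_pow[OF m(1)] by blast
    then have "h 0 < k1 ^ n * \<rho>"
      using \<rho> by (simp add: field_simps)
    with width_geometric_decay[OF mesh, of n] have "k1 ^ n * h n < k1 ^ n * \<rho>"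
      by linarith
    then have "h n \<le> \<rho>"
      using m(1) by simp
    define L where "L = (LEAST l. h l \<le> \<rho>)"
    have hL: "h L \<le> \<rho>"
      unfolding L_def using \<open>h n \<le> \<rho>\<close> by (rule LeastI)
    with \<open>\<rho> < h 0\<close> obtain L' where L': "L = Suc L'"
      by (cases L) auto
    then have "\<rho> < h L'"
      using not_less_Least[of L' "\<lambda>l. h l \<le> \<rho>"] by (simp add: L_def)
    also have "\<dots> \<le> k2 * h L"
      using m(5) L' by simp
    finally have lower: "c / k2 * \<epsilon> powr (1 / (2 * s)) \<le> h L"
      using k2 by (simp add: \<rho>_def field_simps)
    have "h L powr (4 * s) \<le> \<rho> powr (4 * s)"
      using hL m(3)[of L] \<open>0 < s\<close> by (intro powr_mono2) auto
    also have "\<dots> = c powr (4 * s) * \<epsilon>\<^sup>2"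
      using c \<epsilon> \<open>0 < s\<close> by (simp add: \<rho>_def powr_mult powr_powr flip: powr_numeral)
    also have "\<dots> \<le> 1 / (2 * K) * \<epsilon>\<^sup>2"
    proof (rule mult_right_mono)
      have "c powr (4 * s) \<le> ((1 / (2 * K)) powr (1 / (4 * s))) powr (4 * s)"
        using c \<open>0 < s\<close> by (intro powr_mono2) (auto simp: c_def)
      also have "\<dots> = 1 / (2 * K)"
        using \<open>0 < K\<close> \<open>0 < s\<close> by (simp add: powr_powr)
      finally show "c powr (4 * s) \<le> 1 / (2 * K)" .
    qed simp
    finally have "K * h L powr (4 * s) \<le> \<epsilon>\<^sup>2 / 2"
      using \<open>0 < K\<close> by (simp add: field_simps)
    with lower show ?thesis by blast
  qed
  then show ?thesis
    using c k2 by (intro exI[of _ "c / k2"]) auto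
qed

lemma powr_neg_le_of_width_ge:
  fixes x :: real
  assumes "0 < b" "0 < \<epsilon>" "b * \<epsilon> powr (1 / (2 * s)) \<le> x" "0 \<le> a"
  shows "x powr (- a) \<le> b powr (- a) * \<epsilon> powr (- a / (2 * s))"
proof -
  have "x powr (- a) \<le> (b * \<epsilon> powr (1 / (2 * s))) powr (- a)"
    using assms by (intro powr_mono2') auto
  also have "\<dots> = b powr (- a) * \<epsilon> powr (- a / (2 * s))"
    using assms by (simp add: powr_mult powr_powr)
  finally show ?thesis .
qed

section \<open>Single-level estimators\<close>

text \<open>The cost is the number of samples times the cost of one sample; the first is determined by the
  sampling error alone and the second by the bias alone.\<close>

lemma single_level_complexity:
  fixes h C :: "nat \<Rightarrow> real" and err :: "nat \<Rightarrow> nat \<Rightarrow> ennreal"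
  assumes mesh: "mesh_width_sequence k1 k2 h"
    and "0 < s" "0 < \<gamma>" "0 < C\<^sub>\<gamma>" "0 < \<kappa>" "0 < \<delta>" "0 < K"
    and cost: "\<And>l. C l \<le> C\<^sub>\<gamma> * h l powr (- \<gamma>)"
    and err: "\<And>l N. N \<ge> 2 \<Longrightarrow>
      err l N \<le> ennreal (K * (real N powr (- 1 / \<delta>) + h l powr (4 * s)))"
  shows "\<exists>c>0. \<forall>\<epsilon>. 0 < \<epsilon> \<and> \<epsilon> < 1 \<longrightarrow>
     (\<exists>l N. N \<ge> 2 \<and> err l N \<le> ennreal (\<epsilon>\<^sup>2) \<and>
        sample_cost \<kappa> C l N \<le> c * \<epsilon> powr (- 2 * \<delta> - \<gamma> / (2 * s)))"
proof -
  obtain b where "0 < b" and level: "\<And>\<epsilon>. 0 < \<epsilon> \<Longrightarrow> \<epsilon> < 1 \<Longrightarrow>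
      \<exists>L. K * h L powr (4 * s) \<le> \<epsilon>\<^sup>2 / 2 \<and> b * \<epsilon> powr (1 / (2 * s)) \<le> h L"
    using level_resolving_accuracy[OF mesh \<open>0 < s\<close> \<open>0 < K\<close>] by blast
  define A where "A = (2 * K) powr \<delta> + 3"
  define B where "B = C\<^sub>\<gamma> * b powr (- \<gamma>)"
  have pos: "0 < A" "0 < B"
    using assms \<open>0 < b\<close> by (auto simp: A_def B_def add_nonneg_pos)
  have "\<exists>l N. N \<ge> 2 \<and> err l N \<le> ennreal (\<epsilon>\<^sup>2) \<and>
        sample_cost \<kappa> C l N \<le> \<kappa> * (A * B) * \<epsilon> powr (- 2 * \<delta> - \<gamma> / (2 * s))"
    if \<epsilon>: "0 < \<epsilon>" "\<epsilon> < 1" for \<epsilon>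
  proof -
    obtain l where l: "K * h l powr (4 * s) \<le> \<epsilon>\<^sup>2 / 2" "b * \<epsilon> powr (1 / (2 * s)) \<le> h l"
      using level \<epsilon> by blast
    \<comment> \<open>\<open>x\<close> solves \<open>K x\<^bsup>-1/\<delta>\<^esup> = \<epsilon>\<^sup>2 / 2\<close>.\<close>
    define x where "x = (2 * K) powr \<delta> * \<epsilon> powr (- 2 * \<delta>)"
    define N where "N = nat \<lceil>x\<rceil> + 2"
    have x: "0 < x"
      using \<open>0 < K\<close> \<epsilon> by (simp add: x_def)
    have N: "x \<le> real N" "real N \<le> x + 3"
      using x unfolding N_def by linarith+
    have "real N powr (- 1 / \<delta>) \<le> x powr (- 1 / \<delta>)"
      using N x \<open>0 < \<delta>\<close> by (intro powr_mono2') auto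
    also have "\<dots> = ((2 * K) powr \<delta>) powr (- 1 / \<delta>) * (\<epsilon> powr (- 2 * \<delta>)) powr (- 1 / \<delta>)"
      unfolding x_def by (rule powr_mult)
    also have "\<dots> = (2 * K) powr (- 1) * \<epsilon> powr 2"
      using \<open>0 < \<delta>\<close> by (simp only: powr_powr) simp
    also have "\<dots> = \<epsilon>\<^sup>2 / (2 * K)"
      using \<open>0 < K\<close> \<epsilon> by (simp add: powr_minus_divide)
    finally have "K * real N powr (- 1 / \<delta>) \<le> \<epsilon>\<^sup>2 / 2"
      using \<open>0 < K\<close> by (simp add: field_simps)
    with l(1) have "K * (real N powr (- 1 / \<delta>) + h l powr (4 * s)) \<le> \<epsilon>\<^sup>2"
      by (simp add: algebra_simps)
    moreover have "N \<ge> 2"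
      by (simp add: N_def)
    ultimately have acc: "err l N \<le> ennreal (\<epsilon>\<^sup>2)"
      using err[of N l] by (meson ennreal_leI order_trans)
    have "1 \<le> \<epsilon> powr (- 2 * \<delta>)"
      using \<epsilon> \<open>0 < \<delta>\<close> powr_mono'[of "- 2 * \<delta>" 0 \<epsilon>] by simp
    then have N_le: "real N \<le> A * \<epsilon> powr (- 2 * \<delta>)"
      using N(2) by (simp add: A_def x_def algebra_simps)
    have "C l \<le> B * \<epsilon> powr (- \<gamma> / (2 * s))"
    proof -
      have "C\<^sub>\<gamma> * h l powr (- \<gamma>) \<le> C\<^sub>\<gamma> * (b powr (- \<gamma>) * \<epsilon> powr (- \<gamma> / (2 * s)))"
        using powr_neg_le_of_width_ge[OF \<open>0 < b\<close> \<epsilon>(1) l(2)] assms(3,4) by (intro mult_left_mono) auto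
      with cost[of l] show ?thesis by (simp add: B_def)
    qed
    then have "real N * C l \<le> real N * (B * \<epsilon> powr (- \<gamma> / (2 * s)))"
      by (intro mult_left_mono) auto
    also have "\<dots> \<le> (A * \<epsilon> powr (- 2 * \<delta>)) * (B * \<epsilon> powr (- \<gamma> / (2 * s)))"
      using N_le pos by (intro mult_right_mono) auto
    also have "\<dots> = A * B * \<epsilon> powr (- 2 * \<delta> - \<gamma> / (2 * s))"
      by (simp add: powr_diff powr_minus_divide)
    finally have "sample_cost \<kappa> C l N \<le> \<kappa> * (A * B) * \<epsilon> powr (- 2 * \<delta> - \<gamma> / (2 * s))"
      using \<open>0 < \<kappa>\<close> by (simp add: sample_cost_def)
    with acc \<open>N \<ge> 2\<close> show ?thesis by blast
  qed
  then show ?thesis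
    using pos \<open>0 < \<kappa>\<close> by (intro exI[of _ "\<kappa> * (A * B)"]) auto
qed

section \<open>The multilevel estimator\<close>

text \<open>Minimising \<open>\<Sum>\<^sub>l N\<^sub>l c\<^sub>l\<close> subject to \<open>\<Sum>\<^sub>l v\<^sub>l / N\<^sub>l = 1 / T\<close> over real \<open>N\<^sub>l\<close> by a Lagrange multiplier gives
  \<open>N\<^sub>l = T S sqrt (v\<^sub>l / c\<^sub>l)\<close> with \<open>S = \<Sum>\<^sub>l sqrt (v\<^sub>l c\<^sub>l)\<close>, at cost \<open>T S\<^sup>2\<close>. Rounding up can only reduce the
  error, and adds at most one sample per level.\<close>

lemma optimal_sample_allocation:
  fixes v c :: "nat \<Rightarrow> real"
  assumes "0 < T" and v: "\<And>l. 0 < v l" and c: "\<And>l. 0 < c l"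
  shows "\<exists>N :: nat \<Rightarrow> nat. (\<forall>l. N l \<ge> 1) \<and> (\<Sum>l = 0..L. v l / real (N l)) \<le> 1 / T \<and>
    (\<Sum>l = 0..L. real (N l) * c l) \<le> T * (\<Sum>l = 0..L. sqrt (v l * c l))\<^sup>2 + (\<Sum>l = 0..L. c l)"
proof -
  define S where "S = (\<Sum>l = 0..L. sqrt (v l * c l))"
  have S: "0 < S"
    unfolding S_def using v c by (intro sum_pos) auto
  define x where "x l = T * S * sqrt (v l / c l)" for l
  define N where "N l = nat \<lceil>x l\<rceil>" for l
  have x: "0 < x l" for l
    using \<open>0 < T\<close> S v c by (simp add: x_def)
  have N: "x l \<le> real (N l)" "real (N l) \<le> x l + 1" for l
    using x[of l] unfolding N_def by linarith+
  have eq: "v l / sqrt (v l / c l) = sqrt (v l * c l)" "sqrt (v l / c l) * c l = sqrt (v l * c l)" for l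
  proof -
    have "v l = sqrt (v l) * sqrt (v l)" "c l = sqrt (c l) * sqrt (c l)"
      using v[of l] c[of l] by auto
    then show "v l / sqrt (v l / c l) = sqrt (v l * c l)" "sqrt (v l / c l) * c l = sqrt (v l * c l)"
      using v[of l] c[of l] by (auto simp: real_sqrt_divide real_sqrt_mult field_simps)
  qed
  show ?thesis
  proof (intro exI[of _ N] conjI allI)
    show "N l \<ge> 1" for l
      using x[of l] N(1)[of l] by linarith
    have "(\<Sum>l = 0..L. v l / real (N l)) \<le> (\<Sum>l = 0..L. v l / x l)"
    proof (rule sum_mono)
      show "v l / real (N l) \<le> v l / x l" for l
        using v[of l] x[of l] N(1)[of l] by (intro divide_left_mono) auto
    qed
    also have "\<dots> = (\<Sum>l = 0..L. 1 / (T * S) * sqrt (v l * c l))"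
      by (intro sum.cong) (auto simp: x_def simp flip: eq(1))
    also have "\<dots> = 1 / (T * S) * S"
      by (simp only: S_def sum_distrib_left)
    also have "\<dots> = 1 / T"
      using S by simp
    finally show "(\<Sum>l = 0..L. v l / real (N l)) \<le> 1 / T" .
    have "(\<Sum>l = 0..L. real (N l) * c l) \<le> (\<Sum>l = 0..L. (x l + 1) * c l)"
    proof (rule sum_mono)
      show "real (N l) * c l \<le> (x l + 1) * c l" for l
        using c[of l] N(2)[of l] by (intro mult_right_mono) auto
    qed
    also have "\<dots> = (\<Sum>l = 0..L. T * S * sqrt (v l * c l) + c l)"
      unfolding x_def eq(2)[symmetric] by (intro sum.cong refl) (simp add: algebra_simps)
    also have "\<dots> = T * S * S + (\<Sum>l = 0..L. c l)"
      by (simp only: S_def sum_distrib_left sum.distrib)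
    finally show "(\<Sum>l = 0..L. real (N l) * c l) \<le> T * (\<Sum>l = 0..L. sqrt (v l * c l))\<^sup>2 + (\<Sum>l = 0..L. c l)"
      by (simp add: S_def power2_eq_square algebra_simps)
  qed
qed

text \<open>A correction on level \<open>l\<close> also needs a sample on level \<open>l - 1\<close>. Its cost obeys the bound for
  the finer level \<open>l\<close>, which explains the factor \<open>2\<close>.\<close>

lemma MLMC_cost_le:
  fixes h C :: "nat \<Rightarrow> real"
  assumes mesh: "mesh_width_sequence k1 k2 h"
    and pos: "0 < \<gamma>" "0 < C\<^sub>\<gamma>" "0 < \<kappa>"
    and cost: "\<And>l. C l \<le> C\<^sub>\<gamma> * h l powr (- \<gamma>)"
  shows "MLMC_cost \<kappa> C L N \<le> 2 * \<kappa> * C\<^sub>\<gamma> * (\<Sum>l = 0..L. real (N l) * h l powr (- \<gamma>))"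
proof -
  have "C 0 \<le> 2 * C\<^sub>\<gamma> * h 0 powr (- \<gamma>)"
  proof -
    have "0 \<le> C\<^sub>\<gamma> * h 0 powr (- \<gamma>)"
      using pos by simp
    with cost[of 0] show ?thesis by linarith
  qed
  moreover have "C l + C (l - 1) \<le> 2 * C\<^sub>\<gamma> * h l powr (- \<gamma>)" if "1 \<le> l" for l
  proof -
    obtain l' where l': "l = Suc l'"
      using \<open>1 \<le> l\<close> by (cases l) auto
    have "h l \<le> h l'"
      using mesh unfolding l' mesh_width_sequence_def by (simp add: less_imp_le)
    then have "h l' powr (- \<gamma>) \<le> h l powr (- \<gamma>)"
      using pos mesh_width_sequenceD(3)[OF mesh, of l] by (intro powr_mono2') auto
    then have "C\<^sub>\<gamma> * h l' powr (- \<gamma>) \<le> C\<^sub>\<gamma> * h l powr (- \<gamma>)"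
      using pos by simp
    with cost[of l] cost[of l'] show ?thesis
      by (simp add: l')
  qed
  ultimately have "real (N 0) * C 0 + (\<Sum>l = 1..L. real (N l) * (C l + C (l - 1)))
      \<le> real (N 0) * (2 * C\<^sub>\<gamma> * h 0 powr (- \<gamma>)) + (\<Sum>l = 1..L. real (N l) * (2 * C\<^sub>\<gamma> * h l powr (- \<gamma>)))"
    by (intro add_mono sum_mono mult_left_mono) auto
  also have "\<dots> = (\<Sum>l = 0..L. real (N l) * (2 * C\<^sub>\<gamma> * h l powr (- \<gamma>)))"
    by (simp add: sum.atLeast_Suc_atMost)
  also have "\<dots> = 2 * C\<^sub>\<gamma> * (\<Sum>l = 0..L. real (N l) * h l powr (- \<gamma>))"
    by (simp add: sum_distrib_left algebra_simps)
  finally show ?thesis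
    using pos by (simp add: MLMC_cost_def)
qed

lemma less_one_of_less_exp_neg_one: "\<epsilon> < 1" if "\<epsilon> < exp (- 1)" for \<epsilon> :: real
  using that by (smt (verit) exp_less_one_iff)

lemma one_le_neg_ln: "1 \<le> - ln \<epsilon>" if "0 < \<epsilon>" "\<epsilon> < exp (- 1)" for \<epsilon> :: real
proof -
  have "ln \<epsilon> < ln (exp (- 1))"
    using that by (intro ln_strict_mono) auto
  then show ?thesis by simp
qed

text \<open>By geometric decay, a width of order \<open>\<epsilon>\<^bsup>1/(2s)\<^esup>\<close> is reached after \<open>O(\<bar>log \<epsilon>\<bar>)\<close> levels. For
  \<open>\<epsilon> < 1/e\<close> moreover \<open>- log \<epsilon> \<ge> 1\<close>, so the factor \<open>B\<close> absorbs the additive constants.\<close>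

lemma level_number_le_log:
  fixes h :: "nat \<Rightarrow> real"
  assumes mesh: "mesh_width_sequence k1 k2 h" and "0 < s" and "0 < b"
  shows "\<exists>B>0. \<forall>\<epsilon> L. 0 < \<epsilon> \<and> \<epsilon> < exp (- 1) \<and> b * \<epsilon> powr (1 / (2 * s)) \<le> h L
           \<longrightarrow> real (Suc L) \<le> B * (- ln \<epsilon>)"
proof -
  note m = mesh_width_sequenceD[OF mesh]
  define d where "d = \<bar>ln (h 0 / b)\<bar>"
  have k: "0 < ln k1"
    using m(1) by simp
  have "real (Suc L) \<le> ((d + 1 / (2 * s)) / ln k1 + 1) * (- ln \<epsilon>)"
    if \<epsilon>: "0 < \<epsilon>" "\<epsilon> < exp (- 1)" and L: "b * \<epsilon> powr (1 / (2 * s)) \<le> h L" for \<epsilon> L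
  proof -
    have ln: "1 \<le> - ln \<epsilon>"
      by (rule one_le_neg_ln[OF \<epsilon>])
    have "k1 ^ L * (b * \<epsilon> powr (1 / (2 * s))) \<le> k1 ^ L * h L"
      using L m(1) by (intro mult_left_mono) auto
    also have "\<dots> \<le> h 0"
      by (rule width_geometric_decay[OF mesh])
    finally have "ln (k1 ^ L * (b * \<epsilon> powr (1 / (2 * s)))) \<le> ln (h 0)"
      using m(1) m(3)[of 0] \<open>0 < b\<close> \<epsilon>(1) by (intro ln_mono) auto
    then have "real L * ln k1 + ln b + ln \<epsilon> / (2 * s) \<le> ln (h 0)"
      using m(1) \<open>0 < b\<close> \<epsilon>(1) by (simp add: ln_mult ln_realpow ln_powr)
    then have "real L * ln k1 \<le> d * 1 + 1 / (2 * s) * (- ln \<epsilon>)"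
      using \<open>0 < b\<close> m(3)[of 0] by (simp add: d_def ln_div)
    also have "\<dots> \<le> d * (- ln \<epsilon>) + 1 / (2 * s) * (- ln \<epsilon>)"
      using ln by (intro add_right_mono mult_left_mono) (auto simp: d_def)
    finally have "real L \<le> (d + 1 / (2 * s)) / ln k1 * (- ln \<epsilon>)"
      using k by (simp add: pos_le_divide_eq algebra_simps add_divide_distrib[symmetric])
    with ln show ?thesis
      by (simp add: algebra_simps)
  qed
  moreover have "0 < (d + 1 / (2 * s)) / ln k1 + 1"
    using k \<open>0 < s\<close> by (intro add_nonneg_pos) (auto simp: d_def)
  ultimately show ?thesis by blast
qed

definition multilevel_rate :: "real \<Rightarrow> real \<Rightarrow> real \<Rightarrow> real" where
  "multilevel_rate s \<gamma> \<epsilon> =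
     (if s > \<gamma> / 4 then \<epsilon> powr (- 2)
      else if s = \<gamma> / 4 then \<epsilon> powr (- 2) * (ln \<epsilon>)\<^sup>2
      else \<epsilon> powr (- \<gamma> / (2 * s)))"

text \<open>A single sample on the finest level, of width proportional to \<open>\<epsilon>\<^bsup>1/(2s)\<^esup>\<close>, is affordable in all three
  regimes, because \<open>\<gamma> / (2 s) \<le> 2\<close> whenever \<open>s \<ge> \<gamma> / 4\<close>. This controls the effect of rounding the
  sample numbers.\<close>

lemma finest_level_cost_le_multilevel_rate:
  assumes "0 < s" "0 < \<gamma>" and \<epsilon>: "0 < \<epsilon>" "\<epsilon> < exp (- 1)"
  shows "\<epsilon> powr (- \<gamma> / (2 * s)) \<le> multilevel_rate s \<gamma> \<epsilon>"
proof -
  have "\<epsilon> < 1"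
    by (rule less_one_of_less_exp_neg_one[OF \<epsilon>(2)])
  have ln: "1 \<le> - ln \<epsilon>"
    by (rule one_le_neg_ln[OF \<epsilon>])
  have "\<epsilon> powr (- \<gamma> / (2 * s)) \<le> \<epsilon> powr (- 2)" if "\<gamma> / 4 \<le> s"
    using that assms \<open>\<epsilon> < 1\<close> by (intro powr_mono') (auto simp: field_simps)
  moreover have "1 \<le> (ln \<epsilon>)\<^sup>2"
    using power_mono[OF ln, of 2] by simp
  then have "\<epsilon> powr (- 2) * 1 \<le> \<epsilon> powr (- 2) * (ln \<epsilon>)\<^sup>2"
    by (intro mult_left_mono) auto
  ultimately show ?thesis
    unfolding multilevel_rate_def by auto
qed

text \<open>The source of the three regimes: the sign of the exponent \<open>\<tau> = 2 s - \<gamma> / 2\<close> decides which levels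
  dominate. For \<open>\<tau> < 0\<close> the finest level gives \<open>\<epsilon>\<^bsup>-2\<^esup> (\<epsilon>\<^bsup>\<tau>/(2s)\<^esup>)\<^sup>2 = \<epsilon>\<^bsup>-\<gamma>/(2s)\<^esup>\<close>, the cost of one sample on that
  level.\<close>

lemma sum_level_weights_le_multilevel_rate:
  fixes h :: "nat \<Rightarrow> real"
  assumes mesh: "mesh_width_sequence k1 k2 h" and "0 < s" "0 < \<gamma>" "0 < b"
  shows "\<exists>D>0. \<forall>\<epsilon> L. 0 < \<epsilon> \<and> \<epsilon> < exp (- 1) \<and> b * \<epsilon> powr (1 / (2 * s)) \<le> h L \<longrightarrow>
     \<epsilon> powr (- 2) * (\<Sum>l = 0..L. h l powr (2 * s - \<gamma> / 2))\<^sup>2 \<le> D * multilevel_rate s \<gamma> \<epsilon>"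
proof -
  note m = mesh_width_sequenceD[OF mesh]
  define \<tau> where "\<tau> = 2 * s - \<gamma> / 2"
  define S where "S L = (\<Sum>l = 0..L. h l powr \<tau>)" for L
  have S: "0 \<le> S L" for L
    by (simp add: S_def sum_nonneg)
  consider "s > \<gamma> / 4" | "s = \<gamma> / 4" | "s < \<gamma> / 4"
    by linarith
  then have "\<exists>D>0. \<forall>\<epsilon> L. 0 < \<epsilon> \<and> \<epsilon> < exp (- 1) \<and> b * \<epsilon> powr (1 / (2 * s)) \<le> h L \<longrightarrow>
     \<epsilon> powr (- 2) * (S L)\<^sup>2 \<le> D * multilevel_rate s \<gamma> \<epsilon>"
  proof cases
    case 1
    define B where "B = h 0 powr \<tau> / (1 - k1 powr (- \<tau>))"
    have "0 < \<tau>"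
      using 1 by (simp add: \<tau>_def)
    then have "0 < B"
      using geometric_ratio_bounds[OF mesh, of \<tau>] m(3)[of 0] by (simp add: B_def)
    have "S L \<le> B" for L
      using sum_width_powr_pos_le[OF mesh \<open>0 < \<tau>\<close>] by (simp add: S_def B_def)
    then have "(S L)\<^sup>2 \<le> B\<^sup>2" for L
      using S by (simp add: power_mono)
    then have "\<epsilon> powr (- 2) * (S L)\<^sup>2 \<le> B\<^sup>2 * multilevel_rate s \<gamma> \<epsilon>" for \<epsilon> L
      using 1 mult_right_mono[of "(S L)\<^sup>2" "B\<^sup>2" "\<epsilon> powr (- 2)"]
      by (simp add: multilevel_rate_def mult.commute)
    with \<open>0 < B\<close> show ?thesis
      by (intro exI[of _ "B\<^sup>2"]) auto
  next
    case 2
    obtain B where "0 < B" and B: "\<And>\<epsilon> L. 0 < \<epsilon> \<Longrightarrow> \<epsilon> < exp (- 1) \<Longrightarrow>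
        b * \<epsilon> powr (1 / (2 * s)) \<le> h L \<Longrightarrow> real (Suc L) \<le> B * (- ln \<epsilon>)"
      using level_number_le_log[OF mesh \<open>0 < s\<close> \<open>0 < b\<close>] by blast
    have "h l powr \<tau> = 1" for l
    proof -
      have "\<tau> = 0"
        using 2 by (simp add: \<tau>_def)
      with m(3)[of l] show ?thesis by simp
    qed
    then have SL: "S L = real (Suc L)" for L
      by (simp add: S_def)
    have "\<epsilon> powr (- 2) * (S L)\<^sup>2 \<le> B\<^sup>2 * multilevel_rate s \<gamma> \<epsilon>"
      if "0 < \<epsilon>" "\<epsilon> < exp (- 1)" "b * \<epsilon> powr (1 / (2 * s)) \<le> h L" for \<epsilon> L
    proof -
      have "(S L)\<^sup>2 \<le> (B * (- ln \<epsilon>))\<^sup>2"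
        using B[OF that] unfolding SL by (intro power_mono) auto
      then have "\<epsilon> powr (- 2) * (S L)\<^sup>2 \<le> \<epsilon> powr (- 2) * (B\<^sup>2 * (ln \<epsilon>)\<^sup>2)"
        by (intro mult_left_mono) (auto simp: power_mult_distrib)
      with 2 show ?thesis
        by (simp add: multilevel_rate_def mult_ac)
    qed
    with \<open>0 < B\<close> show ?thesis
      by (intro exI[of _ "B\<^sup>2"]) auto
  next
    case 3
    define r where "r = 1 - k1 powr \<tau>"
    have "\<tau> < 0"
      using 3 by (simp add: \<tau>_def)
    then have r: "0 < r"
      using geometric_ratio_bounds[OF mesh, of "- \<tau>"] by (simp add: r_def)
    have "\<epsilon> powr (- 2) * (S L)\<^sup>2 \<le> (b powr \<tau> / r)\<^sup>2 * multilevel_rate s \<gamma> \<epsilon>"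
      if \<epsilon>: "0 < \<epsilon>" "\<epsilon> < exp (- 1)" and L: "b * \<epsilon> powr (1 / (2 * s)) \<le> h L" for \<epsilon> L
    proof -
      have "S L \<le> h L powr \<tau> / r"
        using sum_width_powr_neg_le[OF mesh, of "- \<tau>" L] \<open>\<tau> < 0\<close> by (simp add: S_def r_def)
      also have "\<dots> \<le> b powr \<tau> * \<epsilon> powr (\<tau> / (2 * s)) / r"
        using powr_neg_le_of_width_ge[OF \<open>0 < b\<close> \<epsilon>(1) L, of "- \<tau>"] \<open>\<tau> < 0\<close> r
        by (intro divide_right_mono) auto
      finally have "(S L)\<^sup>2 \<le> (b powr \<tau> / r * \<epsilon> powr (\<tau> / (2 * s)))\<^sup>2"
        using S by (intro power_mono) auto
      also have "\<dots> = (b powr \<tau> / r)\<^sup>2 * \<epsilon> powr (\<tau> / s)"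
        by (simp only: power_mult_distrib) (simp add: power2_eq_square flip: powr_add)
      also have "\<tau> / s = 2 + (- \<gamma> / (2 * s))"
        using \<open>0 < s\<close> by (simp add: \<tau>_def field_simps)
      finally have "\<epsilon> powr (- 2) * (S L)\<^sup>2
          \<le> \<epsilon> powr (- 2) * ((b powr \<tau> / r)\<^sup>2 * \<epsilon> powr (2 + (- \<gamma> / (2 * s))))"
        by (intro mult_left_mono) auto
      also have "\<dots> = (b powr \<tau> / r)\<^sup>2 * (\<epsilon> powr (- 2) * \<epsilon> powr (2 + (- \<gamma> / (2 * s))))"
        by (rule mult.left_commute)
      also have "\<epsilon> powr (- 2) * \<epsilon> powr (2 + (- \<gamma> / (2 * s))) = multilevel_rate s \<gamma> \<epsilon>"
        using 3 by (simp add: multilevel_rate_def flip: powr_add)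
      finally show ?thesis .
    qed
    moreover have "0 < (b powr \<tau> / r)\<^sup>2"
      using r \<open>0 < b\<close> by simp
    ultimately show ?thesis
      by blast
  qed
  then show ?thesis
    by (simp add: S_def \<tau>_def)
qed

text \<open>The optimal allocation is applied with the tolerance \<open>1 / T = \<epsilon>\<^sup>2 / (2 K)\<close> for the sampling error.
  Its main cost is bounded by \<open>sum_level_weights_le_multilevel_rate\<close>, its rounding cost by
  a geometric sum dominated by one sample on the finest level.\<close>

lemma multilevel_complexity:
  fixes h C :: "nat \<Rightarrow> real" and err :: "nat \<Rightarrow> (nat \<Rightarrow> nat) \<Rightarrow> ennreal"
  assumes mesh: "mesh_width_sequence k1 k2 h"
    and "0 < s" "0 < \<gamma>" "0 < C\<^sub>\<gamma>" "0 < \<kappa>" "0 < K"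
    and cost: "\<And>l. C l \<le> C\<^sub>\<gamma> * h l powr (- \<gamma>)"
    and err: "\<And>L N. (\<And>l. l \<le> L \<Longrightarrow> N l \<ge> 1) \<Longrightarrow>
      err L N \<le> ennreal (K * ((\<Sum>l = 0..L. h l powr (4 * s) / real (N l)) + h L powr (4 * s)))"
  shows "\<exists>c>0. \<forall>\<epsilon>. 0 < \<epsilon> \<and> \<epsilon> < exp (- 1) \<longrightarrow>
     (\<exists>L N. (\<forall>l\<le>L. N l \<ge> 1) \<and> err L N \<le> ennreal (\<epsilon>\<^sup>2) \<and>
        MLMC_cost \<kappa> C L N \<le> c * multilevel_rate s \<gamma> \<epsilon>)"
proof -
  note m = mesh_width_sequenceD[OF mesh]
  obtain b where "0 < b" and level: "\<And>\<epsilon>. 0 < \<epsilon> \<Longrightarrow> \<epsilon> < 1 \<Longrightarrow>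
      \<exists>L. K * h L powr (4 * s) \<le> \<epsilon>\<^sup>2 / 2 \<and> b * \<epsilon> powr (1 / (2 * s)) \<le> h L"
    using level_resolving_accuracy[OF mesh \<open>0 < s\<close> \<open>0 < K\<close>] by blast
  obtain D where "0 < D" and weights: "\<And>\<epsilon> L. 0 < \<epsilon> \<Longrightarrow> \<epsilon> < exp (- 1) \<Longrightarrow>
      b * \<epsilon> powr (1 / (2 * s)) \<le> h L \<Longrightarrow>
      \<epsilon> powr (- 2) * (\<Sum>l = 0..L. h l powr (2 * s - \<gamma> / 2))\<^sup>2 \<le> D * multilevel_rate s \<gamma> \<epsilon>"
    using sum_level_weights_le_multilevel_rate[OF mesh assms(2,3) \<open>0 < b\<close>] by blast
  define r where "r = 1 - k1 powr (- \<gamma>)"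
  have r: "0 < r"
    using geometric_ratio_bounds[OF mesh \<open>0 < \<gamma>\<close>] by (simp add: r_def)
  define A where "A = 2 * K * D + b powr (- \<gamma>) / r"
  have "0 < A"
    using \<open>0 < K\<close> \<open>0 < D\<close> \<open>0 < b\<close> r by (simp add: A_def add_pos_pos)
  have "\<exists>L N. (\<forall>l\<le>L. N l \<ge> 1) \<and> err L N \<le> ennreal (\<epsilon>\<^sup>2) \<and>
        MLMC_cost \<kappa> C L N \<le> 2 * \<kappa> * C\<^sub>\<gamma> * A * multilevel_rate s \<gamma> \<epsilon>"
    if \<epsilon>: "0 < \<epsilon>" "\<epsilon> < exp (- 1)" for \<epsilon>
  proof -
    have "\<epsilon> < 1"
      by (rule less_one_of_less_exp_neg_one[OF \<epsilon>(2)])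
    then obtain L where L: "K * h L powr (4 * s) \<le> \<epsilon>\<^sup>2 / 2" "b * \<epsilon> powr (1 / (2 * s)) \<le> h L"
      using level \<epsilon>(1) by blast
    define T where "T = 2 * K * \<epsilon> powr (- 2)"
    have T: "0 < T" "K * (1 / T) = \<epsilon>\<^sup>2 / 2"
      using \<open>0 < K\<close> \<epsilon>(1) by (simp_all add: T_def powr_minus field_simps)
    have powr_pos: "0 < h l powr a" for l a
      using m(3)[of l] by simp
    obtain N :: "nat \<Rightarrow> nat" where N: "\<And>l. N l \<ge> 1"
        "(\<Sum>l = 0..L. h l powr (4 * s) / real (N l)) \<le> 1 / T"
        "(\<Sum>l = 0..L. real (N l) * h l powr (- \<gamma>)) \<le>
           T * (\<Sum>l = 0..L. sqrt (h l powr (4 * s) * h l powr (- \<gamma>)))\<^sup>2 + (\<Sum>l = 0..L. h l powr (- \<gamma>))"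
      using optimal_sample_allocation[where v = "\<lambda>l. h l powr (4 * s)" and c = "\<lambda>l. h l powr (- \<gamma>)"
          and L = L, OF T(1) powr_pos powr_pos] by blast
    have "K * (\<Sum>l = 0..L. h l powr (4 * s) / real (N l)) \<le> K * (1 / T)"
      using N(2) \<open>0 < K\<close> by (intro mult_left_mono) auto
    then have "K * ((\<Sum>l = 0..L. h l powr (4 * s) / real (N l)) + h L powr (4 * s)) \<le> \<epsilon>\<^sup>2"
      using L(1) T(2) by (simp add: distrib_left)
    then have acc: "err L N \<le> ennreal (\<epsilon>\<^sup>2)"
      using err[of L N] N(1) by (meson ennreal_leI order_trans)
    \<comment> \<open>The main cost \<open>T S\<^sup>2\<close>, then the rounding cost.\<close>
    have "sqrt (h l powr (4 * s) * h l powr (- \<gamma>)) = h l powr (2 * s - \<gamma> / 2)" for l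
      using m(3)[of l] by (simp add: powr_half_sqrt[symmetric] powr_powr diff_divide_distrib flip: powr_add)
    then have "T * (\<Sum>l = 0..L. sqrt (h l powr (4 * s) * h l powr (- \<gamma>)))\<^sup>2
        = 2 * K * (\<epsilon> powr (- 2) * (\<Sum>l = 0..L. h l powr (2 * s - \<gamma> / 2))\<^sup>2)"
      by (simp add: T_def)
    also have "\<dots> \<le> 2 * K * (D * multilevel_rate s \<gamma> \<epsilon>)"
      using weights[OF \<epsilon> L(2)] \<open>0 < K\<close> by (intro mult_left_mono) auto
    finally have variance_part: "T * (\<Sum>l = 0..L. sqrt (h l powr (4 * s) * h l powr (- \<gamma>)))\<^sup>2
        \<le> 2 * K * D * multilevel_rate s \<gamma> \<epsilon>"
      by simp
    have "(\<Sum>l = 0..L. h l powr (- \<gamma>)) \<le> h L powr (- \<gamma>) / r"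
      using sum_width_powr_neg_le[OF mesh \<open>0 < \<gamma>\<close>] by (simp add: r_def)
    also have "\<dots> \<le> b powr (- \<gamma>) * multilevel_rate s \<gamma> \<epsilon> / r"
    proof (rule divide_right_mono)
      have "h L powr (- \<gamma>) \<le> b powr (- \<gamma>) * \<epsilon> powr (- \<gamma> / (2 * s))"
        using powr_neg_le_of_width_ge[OF \<open>0 < b\<close> \<epsilon>(1) L(2)] \<open>0 < \<gamma>\<close> by simp
      also have "\<dots> \<le> b powr (- \<gamma>) * multilevel_rate s \<gamma> \<epsilon>"
        using finest_level_cost_le_multilevel_rate[OF assms(2,3) \<epsilon>] by (intro mult_left_mono) auto
      finally show "h L powr (- \<gamma>) \<le> b powr (- \<gamma>) * multilevel_rate s \<gamma> \<epsilon>" .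
    qed (use r in simp)
    finally have "(\<Sum>l = 0..L. real (N l) * h l powr (- \<gamma>)) \<le> A * multilevel_rate s \<gamma> \<epsilon>"
      using N(3) variance_part by (simp add: A_def distrib_right)
    then have "2 * \<kappa> * C\<^sub>\<gamma> * (\<Sum>l = 0..L. real (N l) * h l powr (- \<gamma>))
        \<le> 2 * \<kappa> * C\<^sub>\<gamma> * (A * multilevel_rate s \<gamma> \<epsilon>)"
      using \<open>0 < \<kappa>\<close> \<open>0 < C\<^sub>\<gamma>\<close> by (intro mult_left_mono) auto
    with MLMC_cost_le[where C = C and L = L and N = N, OF mesh assms(3,4,5) cost]
    have "MLMC_cost \<kappa> C L N \<le> 2 * \<kappa> * C\<^sub>\<gamma> * A * multilevel_rate s \<gamma> \<epsilon>"
      by (simp only: mult.assoc)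
    with N(1) acc show ?thesis
      by blast
  qed
  then show ?thesis
    using \<open>0 < \<kappa>\<close> \<open>0 < C\<^sub>\<gamma>\<close> \<open>0 < A\<close> by (intro exI[of _ "2 * \<kappa> * C\<^sub>\<gamma> * A"]) auto
qed

theorem theorem5p5:
  fixes D :: "(real ^ 'd) set"
    and k :: "real ^ 'd \<Rightarrow> real ^ 'J \<Rightarrow> real"
    and f :: "(real ^ 'd \<Rightarrow> real) \<Rightarrow> real"
    and P :: "(real ^ 'J) measure"
    and h :: "nat \<Rightarrow> real" and k1 k2 :: real
    and \<T> :: "nat \<Rightarrow> (real ^ 'd) set set"
    and p :: "real ^ 'J \<Rightarrow> real ^ 'd \<Rightarrow> real"
    and ph :: "nat \<Rightarrow> real ^ 'J \<Rightarrow> real ^ 'd \<Rightarrow> real"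
    and H :: "(real ^ 'd \<Rightarrow> real) \<Rightarrow> real ^ 'm"
    and \<phi> \<theta> \<psi> :: "(real ^ 'd \<Rightarrow> real) \<Rightarrow> real"
    and y :: "real ^ 'm" and \<sigma>\<^sub>\<eta> Q Z :: real
    and M :: "'w measure"
    and XQ XZ :: "nat \<Rightarrow> 'w \<Rightarrow> real ^ 'J"
    and XLQ XLZ :: "nat \<times> nat \<Rightarrow> 'w \<Rightarrow> real ^ 'J"
    and \<Delta>Q \<Delta>Z :: "'w \<Rightarrow> real ^ 'J"
    and z :: "nat \<Rightarrow> nat ^ 'J"
    and mse_MC mse_QMC :: "nat \<Rightarrow> nat \<Rightarrow> ennreal"
    and mse_ML :: "nat \<Rightarrow> (nat \<Rightarrow> nat) \<Rightarrow> ennreal"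
    and C :: "nat \<Rightarrow> real" and C\<^sub>\<gamma> \<gamma> s \<kappa>_MC \<kappa>_QMC \<kappa>_ML :: real
  assumes domain: "lipschitz_polyhedral_domain D"
    and source: "f \<in> Hminus1 D"
    and law: "prob_space P" "sets P = sets borel"
    and widths: "mesh_width_sequence k1 k2 h"
    and meshes: "\<And>l. mesh_of_width D (h l) (\<T> l)"
    and exact: "AE \<xi> in P. the_variational_solution D (\<lambda>x. k x \<xi>) f (H10 D) (p \<xi>)"
    and discrete: "\<And>l. AE \<xi> in P. the_variational_solution D (\<lambda>x. k x \<xi>) f (P1_space D (\<T> l)) (ph l \<xi>)"
    and functionals: "on_H10 D H" "on_H10 D \<phi>"
    and noise: "\<sigma>\<^sub>\<eta> > 0"
    and \<theta>: "\<theta> = likelihood \<sigma>\<^sub>\<eta> y H"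
    and \<psi>: "\<psi> = (\<lambda>v. \<theta> v * \<phi> v)"
    and measurable:
      "(\<lambda>\<xi>. H (p \<xi>)) \<in> borel_measurable P" "(\<lambda>\<xi>. \<phi> (p \<xi>)) \<in> borel_measurable P"
      "\<And>l. (\<lambda>\<xi>. H (ph l \<xi>)) \<in> borel_measurable P" "\<And>l. (\<lambda>\<xi>. \<phi> (ph l \<xi>)) \<in> borel_measurable P"
    and integrable: "integrable P (\<lambda>\<xi>. \<psi> (p \<xi>))"
    and Z: "Z = (LINT \<xi>|P. \<theta> (p \<xi>))"
    and Q: "Q = (LINT \<xi>|P. \<psi> (p \<xi>))"
    and M: "prob_space M"
    and MC_samples: "iid_samples M P XQ" "iid_samples M P XZ"
    and MLMC_samples: "iid_samples M P XLQ" "iid_samples M P XLZ"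
    and shifts: "uniform_shift M \<Delta>Q" "uniform_shift M \<Delta>Z"
    and gen_vectors: "\<And>N j. N \<ge> 2 \<Longrightarrow> z N $ j \<in> {1..N - 1}"
    and mse_MC: "\<And>l N. mse_MC l N = ratio_mse M Q Z
          (MC_est (\<lambda>\<xi>. \<psi> (ph l \<xi>)) XQ N) (MC_est (\<lambda>\<xi>. \<theta> (ph l \<xi>)) XZ N)"
    and mse_QMC: "\<And>l N. mse_QMC l N = ratio_mse M Q Z
          (QMC_est P (\<lambda>\<xi>. \<psi> (ph l \<xi>)) (z N) \<Delta>Q N) (QMC_est P (\<lambda>\<xi>. \<theta> (ph l \<xi>)) (z N) \<Delta>Z N)"
    and mse_ML: "\<And>L N. mse_ML L N = ratio_mse M Q Z
          (MLMC_est (\<lambda>l \<xi>. \<psi> (ph l \<xi>)) XLQ L N) (MLMC_est (\<lambda>l \<xi>. \<theta> (ph l \<xi>)) XLZ L N)"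
    and cost_factors: "\<kappa>_MC > 0" "\<kappa>_QMC > 0" "\<kappa>_ML > 0"
    and s: "0 < s" "s \<le> 1"
    and \<gamma>: "\<gamma> > 0" and C\<^sub>\<gamma>: "C\<^sub>\<gamma> > 0"
    and cost: "\<And>l. 0 \<le> C l" "\<And>l. C l \<le> C\<^sub>\<gamma> * h l powr (- \<gamma>)"
  shows
    "((\<exists>CML>0. \<forall>L N. (\<forall>l\<le>L. N l \<ge> 1) \<longrightarrow>
          mse_ML L N \<le> ennreal (CML * ((\<Sum>l = 0..L. h l powr (4 * s) / real (N l)) + h L powr (4 * s))))
      \<longrightarrow>
      (\<exists>c>0. \<forall>\<epsilon>. 0 < \<epsilon> \<and> \<epsilon> < exp (- 1) \<longrightarrow>
         (\<exists>L N. (\<forall>l\<le>L. N l \<ge> 1) \<and> mse_ML L N \<le> ennreal (\<epsilon>\<^sup>2) \<and>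
            (s > \<gamma> / 4 \<longrightarrow> MLMC_cost \<kappa>_ML C L N \<le> c * \<epsilon> powr (- 2)) \<and>
            (s = \<gamma> / 4 \<longrightarrow> MLMC_cost \<kappa>_ML C L N \<le> c * \<epsilon> powr (- 2) * (ln \<epsilon>)\<^sup>2) \<and>
            (s < \<gamma> / 4 \<longrightarrow> MLMC_cost \<kappa>_ML C L N \<le> c * \<epsilon> powr (- \<gamma> / (2 * s))))))
     \<and>
     ((\<exists>CMC>0. \<forall>l N. N \<ge> 1 \<longrightarrow> mse_MC l N \<le> ennreal (CMC * (1 / real N + h l powr (4 * s))))
      \<longrightarrow>
      (\<exists>c>0. \<forall>\<epsilon>. 0 < \<epsilon> \<and> \<epsilon> < exp (- 1) \<longrightarrow>
         (\<exists>l N. N \<ge> 1 \<and> mse_MC l N \<le> ennreal (\<epsilon>\<^sup>2) \<and>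
            sample_cost \<kappa>_MC C l N \<le> c * \<epsilon> powr (- 2 - \<gamma> / (2 * s)))))
     \<and>
     (\<forall>\<delta>. 1 / 2 < \<delta> \<and> \<delta> \<le> 1 \<longrightarrow>
      (\<exists>CQMC>0. \<forall>l N. N \<ge> 2 \<longrightarrow>
          mse_QMC l N \<le> ennreal (CQMC * (real N powr (- 1 / \<delta>) + h l powr (4 * s))))
      \<longrightarrow>
      (\<exists>c>0. \<forall>\<epsilon>. 0 < \<epsilon> \<and> \<epsilon> < exp (- 1) \<longrightarrow>
         (\<exists>l N. N \<ge> 2 \<and> mse_QMC l N \<le> ennreal (\<epsilon>\<^sup>2) \<and>
            sample_cost \<kappa>_QMC C l N \<le> c * \<epsilon> powr (- 2 * \<delta> - \<gamma> / (2 * s)))))"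
proof (intro conjI impI allI)
  note small = less_one_of_less_exp_neg_one
  show "\<exists>c>0. \<forall>\<epsilon>. 0 < \<epsilon> \<and> \<epsilon> < exp (- 1) \<longrightarrow>
         (\<exists>L N. (\<forall>l\<le>L. N l \<ge> 1) \<and> mse_ML L N \<le> ennreal (\<epsilon>\<^sup>2) \<and>
            (s > \<gamma> / 4 \<longrightarrow> MLMC_cost \<kappa>_ML C L N \<le> c * \<epsilon> powr (- 2)) \<and>
            (s = \<gamma> / 4 \<longrightarrow> MLMC_cost \<kappa>_ML C L N \<le> c * \<epsilon> powr (- 2) * (ln \<epsilon>)\<^sup>2) \<and>
            (s < \<gamma> / 4 \<longrightarrow> MLMC_cost \<kappa>_ML C L N \<le> c * \<epsilon> powr (- \<gamma> / (2 * s))))"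
    if hyp: "\<exists>CML>0. \<forall>L N. (\<forall>l\<le>L. N l \<ge> 1) \<longrightarrow>
          mse_ML L N \<le> ennreal (CML * ((\<Sum>l = 0..L. h l powr (4 * s) / real (N l)) + h L powr (4 * s)))"
  proof -
    obtain K where "0 < K" and K: "\<And>L N. (\<And>l. l \<le> L \<Longrightarrow> N l \<ge> 1) \<Longrightarrow>
        mse_ML L N \<le> ennreal (K * ((\<Sum>l = 0..L. h l powr (4 * s) / real (N l)) + h L powr (4 * s)))"
      using hyp by blast
    obtain c where "0 < c" and c: "\<And>\<epsilon>. 0 < \<epsilon> \<Longrightarrow> \<epsilon> < exp (- 1) \<Longrightarrow>
        \<exists>L N. (\<forall>l\<le>L. N l \<ge> 1) \<and> mse_ML L N \<le> ennreal (\<epsilon>\<^sup>2) \<and>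
          MLMC_cost \<kappa>_ML C L N \<le> c * multilevel_rate s \<gamma> \<epsilon>"
      using multilevel_complexity[OF widths s(1) \<gamma> C\<^sub>\<gamma> cost_factors(3) \<open>0 < K\<close> cost(2) K] by blast
    show ?thesis
    proof (intro exI[of _ c] conjI allI impI \<open>0 < c\<close>)
      fix \<epsilon> :: real
      assume "0 < \<epsilon> \<and> \<epsilon> < exp (- 1)"
      then obtain L N where "\<forall>l\<le>L. N l \<ge> 1" "mse_ML L N \<le> ennreal (\<epsilon>\<^sup>2)"
          "MLMC_cost \<kappa>_ML C L N \<le> c * multilevel_rate s \<gamma> \<epsilon>"
        using c by blast
      then show "\<exists>L N. (\<forall>l\<le>L. N l \<ge> 1) \<and> mse_ML L N \<le> ennreal (\<epsilon>\<^sup>2) \<and>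
            (s > \<gamma> / 4 \<longrightarrow> MLMC_cost \<kappa>_ML C L N \<le> c * \<epsilon> powr (- 2)) \<and>
            (s = \<gamma> / 4 \<longrightarrow> MLMC_cost \<kappa>_ML C L N \<le> c * \<epsilon> powr (- 2) * (ln \<epsilon>)\<^sup>2) \<and>
            (s < \<gamma> / 4 \<longrightarrow> MLMC_cost \<kappa>_ML C L N \<le> c * \<epsilon> powr (- \<gamma> / (2 * s)))"
        by (intro exI[of _ L] exI[of _ N]) (auto simp: multilevel_rate_def mult.assoc)
    qed
  qed
  show "\<exists>c>0. \<forall>\<epsilon>. 0 < \<epsilon> \<and> \<epsilon> < exp (- 1) \<longrightarrow>
         (\<exists>l N. N \<ge> 1 \<and> mse_MC l N \<le> ennreal (\<epsilon>\<^sup>2) \<and>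
            sample_cost \<kappa>_MC C l N \<le> c * \<epsilon> powr (- 2 - \<gamma> / (2 * s)))"
    if hyp: "\<exists>CMC>0. \<forall>l N. N \<ge> 1 \<longrightarrow> mse_MC l N \<le> ennreal (CMC * (1 / real N + h l powr (4 * s)))"
  proof -
    obtain K where "0 < K" and K: "\<And>l N. N \<ge> 1 \<Longrightarrow>
        mse_MC l N \<le> ennreal (K * (1 / real N + h l powr (4 * s)))"
      using hyp by blast
    \<comment> \<open>Plain Monte Carlo has the error bound of quasi-Monte Carlo with \<open>\<delta> = 1\<close>.\<close>
    have "mse_MC l N \<le> ennreal (K * (real N powr (- 1 / 1) + h l powr (4 * s)))" if "N \<ge> 2" for l N
      using K[of N l] that by (simp add: powr_minus_divide)
    from single_level_complexity[where \<delta> = 1, OF widths s(1) \<gamma> C\<^sub>\<gamma> cost_factors(1) _ \<open>0 < K\<close> cost(2) this]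
    obtain c where "0 < c" and c: "\<And>\<epsilon>. 0 < \<epsilon> \<Longrightarrow> \<epsilon> < 1 \<Longrightarrow>
        \<exists>l N. N \<ge> 2 \<and> mse_MC l N \<le> ennreal (\<epsilon>\<^sup>2) \<and>
          sample_cost \<kappa>_MC C l N \<le> c * \<epsilon> powr (- 2 - \<gamma> / (2 * s))"
      by auto
    then show ?thesis
      using small by (meson one_le_numeral order_trans)
  qed
  show "\<exists>c>0. \<forall>\<epsilon>. 0 < \<epsilon> \<and> \<epsilon> < exp (- 1) \<longrightarrow>
         (\<exists>l N. N \<ge> 2 \<and> mse_QMC l N \<le> ennreal (\<epsilon>\<^sup>2) \<and>
            sample_cost \<kappa>_QMC C l N \<le> c * \<epsilon> powr (- 2 * \<delta> - \<gamma> / (2 * s)))"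
    if \<delta>: "1 / 2 < \<delta> \<and> \<delta> \<le> 1"
      and hyp: "\<exists>CQMC>0. \<forall>l N. N \<ge> 2 \<longrightarrow>
          mse_QMC l N \<le> ennreal (CQMC * (real N powr (- 1 / \<delta>) + h l powr (4 * s)))" for \<delta>
  proof -
    have "0 < \<delta>"
      using \<delta> by linarith
    obtain K where "0 < K" and K: "\<And>l N. N \<ge> 2 \<Longrightarrow>
        mse_QMC l N \<le> ennreal (K * (real N powr (- 1 / \<delta>) + h l powr (4 * s)))"
      using hyp by blast
    show ?thesis
      using single_level_complexity[OF widths s(1) \<gamma> C\<^sub>\<gamma> cost_factors(2) \<open>0 < \<delta>\<close> \<open>0 < K\<close> cost(2) K] small
      by blast
  qed
qed

end
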